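(* Let $X\subseteq Y$ be sets of variables and $l=(Fm_\Sigma(X),\vdash)$ a logic whose cardinality $\kappa$ is a regular cardinal. Then, as relations between subsets and elements of $Fm_\Sigma(Y)$, $$\vdash^{ŁS}\ \subseteq\ \vdash^{SS}\ \subseteq\ \vdash^-\ =\ \vdash_{Log_Y(Fi_l)}\ \subseteq\ \vdash^+_\kappa,$$ where $\vdash^{SS}$ is the structural closure of $\vdash^{ŁS}$ and (the closure operator of) $\vdash^-$ is the idempotent hull of (the operator associated to) $\vdash^{SS}$.
   Context: $Fm_\Sigma(Z)$ is the absolutely free $\Sigma$-algebra on $Z$; $X$ is infinite. A logic $(Fm_\Sigma(X),\vdash)$ is a reflexive, monotone, cut-closed, structural relation; its cardinality is the least infinite $\lambda$ such that $\Gamma\vdash\varphi$ implies $\Gamma'\vdash\varphi$ for some $\Gamma'\subseteq\Gamma$ with $|\Gamma'|<\lambda$. Relations on $Fm_\Sigma(Y)$: (a) $\Gamma\vdash^{ŁS}\varphi$ iff there are an automorphism $v$ of $Fm_\Sigma(Y)$ and $\Gamma'\subseteq\Gamma$ with $v(\Gamma'\cup\{\varphi\})\subseteq Fm_\Sigma(X)$ and $v(\Gamma')\vdash v(\varphi)$. (b) $\Gamma\vdash^{SS}\varphi$ iff there are $\Gamma'\cup\{\varphi'\}\subseteq Fm_\Sigma(X)$ and a homomorphism $v\colon Fm_\Sigma(X)\to Fm_\Sigma(Y)$ with $v(\Gamma')\subseteq\Gamma$, $v(\varphi')=\varphi$, $\Gamma'\vdash\varphi'$. (c) $\vdash^-$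 is the smallest consequence relation on $Fm_\Sigma(Y)$ with $\Gamma\vdash^-\varphi$ whenever $\Gamma\cup\{\varphi\}\subseteq Fm_\Sigma(X)$ and $\Gamma\vdash\varphi$. (d) $\Gamma\vdash^+\varphi$ iff $\sigma(\Gamma)\vdash\sigma(\varphi)$ for every homomorphism $\sigma\colon Fm_\Sigma(Y)\to Fm_\Sigma(X)$, and $\Gamma\vdash^+_\kappa\varphi$ iff $\Gamma'\vdash^+\varphi$ for some $\Gamma'\subseteq\Gamma$ with $|\Gamma'|<\kappa$. (e) $\Gamma\vdash_{Log_Y(Fi_l)}\varphi$ iff $\varphi$ lies in every $l$-filter on $Fm_\Sigma(Y)$ containing $\Gamma$, where an $l$-filter on a $\Sigma$-algebra $A$ is $F\subseteq A$ such that $\Gamma\vdash\varphi$ and a homomorphism $v\colon Fm_\Sigma(X)\to A$ with $v(\Gamma)\subseteq F$ imply $v(\varphi)\in F$. The structural closure of a relation is the smallest monotone, reflexive relation containing it that is closed under all endomorphisms of $Fm_\Sigma(Y)$. The idempotent hull of an increasing monotone operator $E$ on $\wp(M)$ is the smallest idempotent operator $C$ with $E(S)\subseteq C(S)$ for all $S$. *)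

theory Defs
  imports Main
begin

unbundle cardinal_syntax

section \<open>Algebras and formula algebras\<close>

text \<open>
  A signature is a set of pairs (operation symbol, finite arity).  A pair \<open>(f, n)\<close> is one
  operation, so the same \<open>f\<close> occurring with two arities counts as two operations; they are told
  apart by the length of the argument list.  Only the values of \<open>opn\<close> at
  lists \<open>as\<close> over the carrier with \<open>(f, length as)\<close> in the signature matter.
\<close>

type_synonym 'f signature = "('f \<times> nat) set"

record ('f, 'a) algebra =
  univ :: "'a set"
  opn :: "'f \<Rightarrow> 'a list \<Rightarrow> 'a"

definition is_algebra :: "'f signature \<Rightarrow> ('f, 'a) algebra \<Rightarrow> bool" where
  "is_algebra \<Sigma> A \<longleftrightarrow>
     (\<forall>f as. (f, length as) \<in> \<Sigma> \<and> set as \<subseteq> univ A \<longrightarrow> opn A f as \<in> univ A)"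

text \<open>
  Homomorphisms are total HOL functions of which only the values on the carrier are constrained.
\<close>

definition Homs :: "'f signature \<Rightarrow> ('f, 'a) algebra \<Rightarrow> ('f, 'b) algebra \<Rightarrow> ('a \<Rightarrow> 'b) set" where
  "Homs \<Sigma> A B = {v. v ` univ A \<subseteq> univ B \<and>
     (\<forall>f as. (f, length as) \<in> \<Sigma> \<and> set as \<subseteq> univ A \<longrightarrow> v (opn A f as) = opn B f (map v as))}"

definition Auts :: "'f signature \<Rightarrow> ('f, 'a) algebra \<Rightarrow> ('a \<Rightarrow> 'a) set" where
  "Auts \<Sigma> A = {v \<in> Homs \<Sigma> A A. bij_betw v (univ A) (univ A)}"

datatype ('f, 'x) fterm = Var 'x | App 'f "('f, 'x) fterm list"

inductive_set terms :: "'f signature \<Rightarrow> 'x set \<Rightarrow> ('f, 'x) fterm set"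
  for \<Sigma> :: "'f signature" and Z :: "'x set" where
  Var: "x \<in> Z \<Longrightarrow> Var x \<in> terms \<Sigma> Z"
| App: "(f, length ts) \<in> \<Sigma> \<Longrightarrow> (\<forall>t\<in>set ts. t \<in> terms \<Sigma> Z) \<Longrightarrow> App f ts \<in> terms \<Sigma> Z"

definition Fm :: "'f signature \<Rightarrow> 'x set \<Rightarrow> ('f, ('f, 'x) fterm) algebra" where
  "Fm \<Sigma> Z = \<lparr>univ = terms \<Sigma> Z, opn = App\<rparr>"

lemma is_algebra_Fm: "is_algebra \<Sigma> (Fm \<Sigma> Z)"
  by (auto simp: is_algebra_def Fm_def intro: terms.App)

text \<open>\<open>Fm \<Sigma> Z\<close> is the absolutely free algebra on \<open>Z\<close>.\<close>

primrec extend :: "('f, 'a) algebra \<Rightarrow> ('x \<Rightarrow> 'a) \<Rightarrow> ('f, 'x) fterm \<Rightarrow> 'a" where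
  "extend A h (Var x) = h x"
| "extend A h (App f ts) = opn A f (map (extend A h) ts)"

lemma extend_in_Homs:
  assumes "is_algebra \<Sigma> A" and "h ` Z \<subseteq> univ A"
  shows "extend A h \<in> Homs \<Sigma> (Fm \<Sigma> Z) A"
proof -
  have "extend A h t \<in> univ A" if "t \<in> terms \<Sigma> Z" for t
    using that
  proof (induction rule: terms.induct)
    case (Var x)
    then show ?case using assms(2) by auto
  next
    case (App f ts)
    then have "(f, length (map (extend A h) ts)) \<in> \<Sigma>" "set (map (extend A h) ts) \<subseteq> univ A"
      by auto
    then show ?case using assms(1) unfolding is_algebra_def extend.simps by blast
  qed
  then show ?thesis by (auto simp: Homs_def Fm_def)
qed

lemma Homs_Fm_unique:
  assumes "v \<in> Homs \<Sigma> (Fm \<Sigma> Z) A" and "w \<in> Homs \<Sigma> (Fm \<Sigma> Z) A"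
    and "\<And>x. x \<in> Z \<Longrightarrow> v (Var x) = w (Var x)" and "t \<in> univ (Fm \<Sigma> Z)"
  shows "v t = w t"
proof -
  have "t \<in> terms \<Sigma> Z" using assms(4) by (simp add: Fm_def)
  then show ?thesis
  proof (induction rule: terms.induct)
    case (Var x)
    then show ?case by (rule assms(3))
  next
    case (App f ts)
    then have "(f, length ts) \<in> \<Sigma>" "set ts \<subseteq> terms \<Sigma> Z" "map v ts = map w ts"
      by auto
    moreover from this have "v (App f ts) = opn A f (map v ts)" "w (App f ts) = opn A f (map w ts)"
      using assms(1,2) by (auto simp: Homs_def Fm_def)
    ultimately show ?case by metis
  qed
qed

section \<open>Consequence relations\<close>

text \<open>
  A relation between subsets and elements of \<open>M\<close> is a subset of \<open>Pow M \<times> M\<close>.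
\<close>

type_synonym 'a crel = "('a set \<times> 'a) set"

definition refl_rel :: "'a set \<Rightarrow> 'a crel \<Rightarrow> bool" where
  "refl_rel M R \<longleftrightarrow> (\<forall>\<Gamma> \<phi>. \<Gamma> \<subseteq> M \<and> \<phi> \<in> \<Gamma> \<longrightarrow> (\<Gamma>, \<phi>) \<in> R)"

definition mono_rel :: "'a set \<Rightarrow> 'a crel \<Rightarrow> bool" where
  "mono_rel M R \<longleftrightarrow> (\<forall>\<Gamma> \<Delta> \<phi>. (\<Gamma>, \<phi>) \<in> R \<and> \<Gamma> \<subseteq> \<Delta> \<and> \<Delta> \<subseteq> M \<longrightarrow> (\<Delta>, \<phi>) \<in> R)"

definition cut_rel :: "'a set \<Rightarrow> 'a crel \<Rightarrow> bool" where
  "cut_rel M R \<longleftrightarrow>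
     (\<forall>\<Gamma> \<Delta> \<phi>. \<Gamma> \<subseteq> M \<and> (\<forall>\<psi>\<in>\<Delta>. (\<Gamma>, \<psi>) \<in> R) \<and> (\<Delta>, \<phi>) \<in> R \<longrightarrow> (\<Gamma>, \<phi>) \<in> R)"

definition structural_rel :: "'f signature \<Rightarrow> 'x set \<Rightarrow> ('f, 'x) fterm crel \<Rightarrow> bool" where
  "structural_rel \<Sigma> Z R \<longleftrightarrow>
     (\<forall>\<sigma> \<in> Homs \<Sigma> (Fm \<Sigma> Z) (Fm \<Sigma> Z). \<forall>(\<Gamma>, \<phi>) \<in> R. (\<sigma> ` \<Gamma>, \<sigma> \<phi>) \<in> R)"

definition is_logic :: "'f signature \<Rightarrow> 'x set \<Rightarrow> ('f, 'x) fterm crel \<Rightarrow> bool" where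
  "is_logic \<Sigma> Z R \<longleftrightarrow> R \<subseteq> Pow (univ (Fm \<Sigma> Z)) \<times> univ (Fm \<Sigma> Z) \<and>
     refl_rel (univ (Fm \<Sigma> Z)) R \<and> mono_rel (univ (Fm \<Sigma> Z)) R \<and>
     cut_rel (univ (Fm \<Sigma> Z)) R \<and> structural_rel \<Sigma> Z R"

text \<open>
  Cardinals are cardinal orders \<open>\<kappa> :: 'k rel\<close> on an arbitrary type.  In \<open>is_cardinality\<close>, it
  suffices to compare \<open>\<kappa>\<close> with cardinals on the same type, since every cardinal below \<open>\<kappa>\<close>
  is isomorphic to the cardinality of some subset of \<open>Field \<kappa>\<close>.
\<close>

definition bounded_by :: "'a crel \<Rightarrow> 'k rel \<Rightarrow> bool" where
  "bounded_by R k \<longleftrightarrow> (\<forall>(\<Gamma>, \<phi>) \<in> R. \<exists>\<Gamma>'. \<Gamma>' \<subseteq> \<Gamma> \<and> |\<Gamma>'| <o k \<and> (\<Gamma>', \<phi>) \<in> R)"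

definition is_cardinality :: "'a crel \<Rightarrow> 'k rel \<Rightarrow> bool" where
  "is_cardinality R \<kappa> \<longleftrightarrow> Cinfinite \<kappa> \<and> bounded_by R \<kappa> \<and>
     (\<forall>k :: 'k rel. Cinfinite k \<and> bounded_by R k \<longrightarrow> \<kappa> \<le>o k)"

section \<open>Extensions of a logic on \<open>Fm \<Sigma> X\<close> to \<open>Fm \<Sigma> Y\<close>\<close>

definition LS_ext ::
  "'f signature \<Rightarrow> 'x set \<Rightarrow> 'x set \<Rightarrow> ('f, 'x) fterm crel \<Rightarrow> ('f, 'x) fterm crel" where
  "LS_ext \<Sigma> X Y R = {(\<Gamma>, \<phi>). \<Gamma> \<subseteq> univ (Fm \<Sigma> Y) \<and> \<phi> \<in> univ (Fm \<Sigma> Y) \<and>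
     (\<exists>v \<in> Auts \<Sigma> (Fm \<Sigma> Y). \<exists>\<Gamma>'. \<Gamma>' \<subseteq> \<Gamma> \<and>
        v ` (\<Gamma>' \<union> {\<phi>}) \<subseteq> univ (Fm \<Sigma> X) \<and> (v ` \<Gamma>', v \<phi>) \<in> R)}"

definition SS_ext ::
  "'f signature \<Rightarrow> 'x set \<Rightarrow> 'x set \<Rightarrow> ('f, 'x) fterm crel \<Rightarrow> ('f, 'x) fterm crel" where
  "SS_ext \<Sigma> X Y R = {(\<Gamma>, \<phi>). \<Gamma> \<subseteq> univ (Fm \<Sigma> Y) \<and> \<phi> \<in> univ (Fm \<Sigma> Y) \<and>
     (\<exists>\<Gamma>' \<phi>'. \<Gamma>' \<union> {\<phi>'} \<subseteq> univ (Fm \<Sigma> X) \<and>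
        (\<exists>v \<in> Homs \<Sigma> (Fm \<Sigma> X) (Fm \<Sigma> Y). v ` \<Gamma>' \<subseteq> \<Gamma> \<and> v \<phi>' = \<phi> \<and> (\<Gamma>', \<phi>') \<in> R))}"

definition minus_ext :: "'f signature \<Rightarrow> 'x set \<Rightarrow> ('f, 'x) fterm crel \<Rightarrow> ('f, 'x) fterm crel" where
  "minus_ext \<Sigma> Y R = \<Inter>{S. is_logic \<Sigma> Y S \<and> R \<subseteq> S}"

lemma minus_ext_smallest: "is_logic \<Sigma> Y S \<Longrightarrow> R \<subseteq> S \<Longrightarrow> minus_ext \<Sigma> Y R \<subseteq> S"
  by (auto simp: minus_ext_def)

lemma minus_ext_is_logic:
  assumes "R \<subseteq> Pow (univ (Fm \<Sigma> Y)) \<times> univ (Fm \<Sigma> Y)"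
  shows "is_logic \<Sigma> Y (minus_ext \<Sigma> Y R)" and "R \<subseteq> minus_ext \<Sigma> Y R"
proof -
  let ?M = "univ (Fm \<Sigma> Y)"
  let ?L = "{S. is_logic \<Sigma> Y S \<and> R \<subseteq> S}"
  have "is_logic \<Sigma> Y (Pow ?M \<times> ?M)"
    by (auto simp: is_logic_def refl_rel_def mono_rel_def cut_rel_def structural_rel_def Homs_def)
  then have sub: "minus_ext \<Sigma> Y R \<subseteq> Pow ?M \<times> ?M"
    using assms by (auto simp: minus_ext_def)
  have "refl_rel ?M (\<Inter>?L)"
    unfolding is_logic_def refl_rel_def by blast
  moreover have "mono_rel ?M (\<Inter>?L)"
    unfolding is_logic_def mono_rel_def by blast
  moreover have "cut_rel ?M (\<Inter>?L)"
    unfolding cut_rel_def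
  proof (intro allI impI InterI)
    fix \<Gamma> \<Delta> \<phi> S
    assume *: "\<Gamma> \<subseteq> ?M \<and> (\<forall>\<psi>\<in>\<Delta>. (\<Gamma>, \<psi>) \<in> \<Inter>?L) \<and> (\<Delta>, \<phi>) \<in> \<Inter>?L" and S: "S \<in> ?L"
    then have "cut_rel ?M S" by (simp add: is_logic_def)
    moreover have "\<forall>\<psi>\<in>\<Delta>. (\<Gamma>, \<psi>) \<in> S" "(\<Delta>, \<phi>) \<in> S" using * S by blast+
    ultimately show "(\<Gamma>, \<phi>) \<in> S" using * unfolding cut_rel_def by blast
  qed
  moreover have "structural_rel \<Sigma> Y (\<Inter>?L)"
    unfolding is_logic_def structural_rel_def by blast
  ultimately show "is_logic \<Sigma> Y (minus_ext \<Sigma> Y R)"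
    using sub unfolding minus_ext_def by (intro is_logic_def[THEN iffD2] conjI)
  show "R \<subseteq> minus_ext \<Sigma> Y R"
    by (auto simp: minus_ext_def)
qed

definition plus_ext ::
  "'f signature \<Rightarrow> 'x set \<Rightarrow> 'x set \<Rightarrow> ('f, 'x) fterm crel \<Rightarrow> ('f, 'x) fterm crel" where
  "plus_ext \<Sigma> X Y R = {(\<Gamma>, \<phi>). \<Gamma> \<subseteq> univ (Fm \<Sigma> Y) \<and> \<phi> \<in> univ (Fm \<Sigma> Y) \<and>
     (\<forall>\<sigma> \<in> Homs \<Sigma> (Fm \<Sigma> Y) (Fm \<Sigma> X). (\<sigma> ` \<Gamma>, \<sigma> \<phi>) \<in> R)}"

definition plus_card_ext ::
  "'f signature \<Rightarrow> 'x set \<Rightarrow> 'x set \<Rightarrow> 'k rel \<Rightarrow> ('f, 'x) fterm crel \<Rightarrow> ('f, 'x) fterm crel" where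
  "plus_card_ext \<Sigma> X Y \<kappa> R = {(\<Gamma>, \<phi>). \<Gamma> \<subseteq> univ (Fm \<Sigma> Y) \<and> \<phi> \<in> univ (Fm \<Sigma> Y) \<and>
     (\<exists>\<Gamma>'. \<Gamma>' \<subseteq> \<Gamma> \<and> |\<Gamma>'| <o \<kappa> \<and> (\<Gamma>', \<phi>) \<in> plus_ext \<Sigma> X Y R)}"

definition filters ::
  "'f signature \<Rightarrow> 'x set \<Rightarrow> ('f, 'x) fterm crel \<Rightarrow> ('f, 'a) algebra \<Rightarrow> 'a set set" where
  "filters \<Sigma> X R A = {F. F \<subseteq> univ A \<and>
     (\<forall>(\<Gamma>, \<phi>) \<in> R. \<forall>v \<in> Homs \<Sigma> (Fm \<Sigma> X) A. v ` \<Gamma> \<subseteq> F \<longrightarrow> v \<phi> \<in> F)}"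

definition Log_filters ::
  "'f signature \<Rightarrow> 'x set \<Rightarrow> 'x set \<Rightarrow> ('f, 'x) fterm crel \<Rightarrow> ('f, 'x) fterm crel" where
  "Log_filters \<Sigma> X Y R = {(\<Gamma>, \<phi>). \<Gamma> \<subseteq> univ (Fm \<Sigma> Y) \<and> \<phi> \<in> univ (Fm \<Sigma> Y) \<and>
     (\<forall>F \<in> filters \<Sigma> X R (Fm \<Sigma> Y). \<Gamma> \<subseteq> F \<longrightarrow> \<phi> \<in> F)}"

section \<open>Structural closure and idempotent hull\<close>

definition is_structural_closure ::
  "'f signature \<Rightarrow> 'x set \<Rightarrow> ('f, 'x) fterm crel \<Rightarrow> ('f, 'x) fterm crel \<Rightarrow> bool" where
  "is_structural_closure \<Sigma> Y R S \<longleftrightarrow>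
     (let M = univ (Fm \<Sigma> Y);
          closed = (\<lambda>T. T \<subseteq> Pow M \<times> M \<and> mono_rel M T \<and> refl_rel M T \<and> structural_rel \<Sigma> Y T \<and> R \<subseteq> T)
      in closed S \<and> (\<forall>T. closed T \<longrightarrow> S \<subseteq> T))"

definition rel_op :: "'a crel \<Rightarrow> 'a set \<Rightarrow> 'a set" where
  "rel_op R \<Gamma> = {\<phi>. (\<Gamma>, \<phi>) \<in> R}"

text \<open>
  Operators on \<open>Pow M\<close> are total HOL functions considered on subsets of \<open>M\<close> only.  The
  competitors \<open>D\<close> below are arbitrary idempotent operators, not required to be monotone.
\<close>

definition idempotent_op :: "'a set \<Rightarrow> ('a set \<Rightarrow> 'a set) \<Rightarrow> bool" where
  "idempotent_op M C \<longleftrightarrow> (\<forall>S\<subseteq>M. C S \<subseteq> M \<and> C (C S) = C S)"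

definition increasing_monotone_op :: "'a set \<Rightarrow> ('a set \<Rightarrow> 'a set) \<Rightarrow> bool" where
  "increasing_monotone_op M E \<longleftrightarrow>
     (\<forall>S\<subseteq>M. S \<subseteq> E S \<and> E S \<subseteq> M) \<and> (\<forall>S T. S \<subseteq> T \<and> T \<subseteq> M \<longrightarrow> E S \<subseteq> E T)"

definition is_idempotent_hull ::
  "'a set \<Rightarrow> ('a set \<Rightarrow> 'a set) \<Rightarrow> ('a set \<Rightarrow> 'a set) \<Rightarrow> bool" where
  "is_idempotent_hull M E C \<longleftrightarrow> increasing_monotone_op M E \<and>
     idempotent_op M C \<and> (\<forall>S\<subseteq>M. E S \<subseteq> C S) \<and>
     (\<forall>D. idempotent_op M D \<and> (\<forall>S\<subseteq>M. E S \<subseteq> D S) \<longrightarrow> (\<forall>S\<subseteq>M. C S \<subseteq> D S))"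

end

(* A set of formulas over Y is an l-filter iff it is closed under the SS operator.  The set of
   consequences of Gamma under any logic on Fm Y extending l is such a filter, because every
   homomorphism from Fm X extends to an endomorphism of Fm Y; its set of plus-kappa consequences
   is one because, kappa being regular, fewer than kappa premise sets of size below kappa can be
   merged.  Both contain Gamma, hence the filter generated by Gamma. *)

theory Submission
  imports Defs
begin

section \<open>Homomorphisms\<close>

lemma Homs_comp:
  assumes "v \<in> Homs \<Sigma> A B" and "w \<in> Homs \<Sigma> B C"
  shows "w \<circ> v \<in> Homs \<Sigma> A C"
proof -
  have "(w \<circ> v) (opn A f as) = opn C f (map (w \<circ> v) as)"
    if "(f, length as) \<in> \<Sigma>" "set as \<subseteq> univ A" for f as
  proof -
    have "set (map v as) \<subseteq> univ B" using that(2) assms(1) by (auto simp: Homs_def)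
    moreover have "(f, length (map v as)) \<in> \<Sigma>" using that(1) by simp
    ultimately have "w (opn B f (map v as)) = opn C f (map w (map v as))"
      using assms(2) unfolding Homs_def by blast
    moreover have "v (opn A f as) = opn B f (map v as)"
      using assms(1) that unfolding Homs_def by blast
    ultimately show ?thesis by simp
  qed
  moreover have "(w \<circ> v) ` univ A \<subseteq> univ C"
    using assms unfolding Homs_def by fastforce
  ultimately show ?thesis by (simp add: Homs_def)
qed

lemma Homs_in_univ: "v \<in> Homs \<Sigma> A B \<Longrightarrow> a \<in> univ A \<Longrightarrow> v a \<in> univ B"
  by (auto simp: Homs_def)

lemma id_in_Auts: "id \<in> Auts \<Sigma> A"
  by (simp add: Auts_def Homs_def)

lemma Fm_mono:
  assumes "X \<subseteq> Y"
  shows "univ (Fm \<Sigma> X) \<subseteq> univ (Fm \<Sigma> Y)"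
proof -
  have "t \<in> terms \<Sigma> Y" if "t \<in> terms \<Sigma> X" for t
    using that by induction (use assms in \<open>auto intro: terms.intros\<close>)
  then show ?thesis by (auto simp: Fm_def)
qed

lemma id_in_Homs_Fm:
  assumes "X \<subseteq> Y"
  shows "id \<in> Homs \<Sigma> (Fm \<Sigma> X) (Fm \<Sigma> Y)"
  using Fm_mono[OF assms] by (simp add: Homs_def) (simp add: Fm_def)

lemma Homs_Fm_restrict:
  assumes "X \<subseteq> Y" and "v \<in> Homs \<Sigma> (Fm \<Sigma> Y) A"
  shows "v \<in> Homs \<Sigma> (Fm \<Sigma> X) A"
  using Homs_comp[OF id_in_Homs_Fm[OF assms(1)] assms(2)] by simp

text \<open>Freeness of the formula algebra: values on the new variables can be chosen at will, and
  two homomorphisms that agree on the variables in X agree on all formulas over X. This is the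
  bridge from homomorphisms out of Fm X, used in filters and in \<open>SS_ext\<close>, to the
  endomorphisms of Fm Y, used in structurality.\<close>

lemma Homs_Fm_extend:
  assumes "X \<subseteq> Y" and "X \<noteq> {}" and "is_algebra \<Sigma> A" and "v \<in> Homs \<Sigma> (Fm \<Sigma> X) A"
  obtains w where "w \<in> Homs \<Sigma> (Fm \<Sigma> Y) A" and "\<And>t. t \<in> univ (Fm \<Sigma> X) \<Longrightarrow> w t = v t"
proof -
  obtain x0 where x0: "x0 \<in> X" using assms(2) by blast
  \<comment> \<open>Variables outside X are treated like the fixed \<open>x0\<close>. Any default
    would do as long as its value lies in the carrier of A, and \<open>v (Var x0)\<close>
    does.\<close>
  define w where "w = extend A (\<lambda>x. v (Var (if x \<in> X then x else x0)))"
  have "Var x \<in> univ (Fm \<Sigma> X)" if "x \<in> X" for x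
    using that by (simp add: Fm_def terms.Var)
  then have w: "w \<in> Homs \<Sigma> (Fm \<Sigma> Y) A"
    unfolding w_def using x0 Homs_in_univ[OF assms(4)]
    by (intro extend_in_Homs assms(3)) auto
  moreover have "w t = v t" if "t \<in> univ (Fm \<Sigma> X)" for t
    by (rule Homs_Fm_unique[OF Homs_Fm_restrict[OF assms(1) w] assms(4) _ that])
      (simp add: w_def)
  ultimately show thesis by (rule that)
qed

text \<open>Applying v to both sides of the homomorphism equation for the inverse gives a true
  identity, and v is injective on the carrier. That A is closed under its operations puts the
  right-hand side in the range of that injectivity.\<close>

lemma inv_into_Auts_in_Homs:
  assumes "is_algebra \<Sigma> A" and "v \<in> Auts \<Sigma> A"
  shows "inv_into (univ A) v \<in> Homs \<Sigma> A A"
proof -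
  let ?u = "inv_into (univ A) v"
  have v: "v \<in> Homs \<Sigma> A A" and bij: "bij_betw v (univ A) (univ A)"
    using assms(2) by (auto simp: Auts_def)
  have u: "?u a \<in> univ A" "v (?u a) = a" if "a \<in> univ A" for a
    using that bij by (auto simp: bij_betw_def inv_into_into f_inv_into_f)
  have "?u (opn A f as) = opn A f (map ?u as)"
    if "(f, length as) \<in> \<Sigma>" "set as \<subseteq> univ A" for f as
  proof -
    have sub: "set (map ?u as) \<subseteq> univ A" and ar: "(f, length (map ?u as)) \<in> \<Sigma>"
      using that u by auto
    have "v (opn A f (map ?u as)) = opn A f (map v (map ?u as))"
      using v sub ar unfolding Homs_def by blast
    also have "map v (map ?u as) = as"
      using that(2) u(2) by (auto intro!: map_idI)
    finally have "v (opn A f (map ?u as)) = opn A f as" .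
    moreover have "opn A f (map ?u as) \<in> univ A"
      using assms(1) sub ar unfolding is_algebra_def by blast
    ultimately show ?thesis
      using bij by (metis bij_betw_inv_into_left)
  qed
  with u(1) show ?thesis by (auto simp: Homs_def)
qed

section \<open>Structural relations\<close>

lemma is_logicD:
  assumes "is_logic \<Sigma> Z R"
  shows is_logic_reflD: "\<Gamma> \<subseteq> univ (Fm \<Sigma> Z) \<Longrightarrow> \<phi> \<in> \<Gamma> \<Longrightarrow> (\<Gamma>, \<phi>) \<in> R"
    and is_logic_monoD: "(\<Gamma>, \<phi>) \<in> R \<Longrightarrow> \<Gamma> \<subseteq> \<Delta> \<Longrightarrow> \<Delta> \<subseteq> univ (Fm \<Sigma> Z) \<Longrightarrow> (\<Delta>, \<phi>) \<in> R"
    and is_logic_cutD: "\<Gamma> \<subseteq> univ (Fm \<Sigma> Z) \<Longrightarrow> (\<And>\<psi>. \<psi> \<in> \<Delta> \<Longrightarrow> (\<Gamma>, \<psi>) \<in> R) \<Longrightarrow>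
      (\<Delta>, \<phi>) \<in> R \<Longrightarrow> (\<Gamma>, \<phi>) \<in> R"
    and is_logic_structuralD: "(\<Gamma>, \<phi>) \<in> R \<Longrightarrow> \<sigma> \<in> Homs \<Sigma> (Fm \<Sigma> Z) (Fm \<Sigma> Z) \<Longrightarrow>
      (\<sigma> ` \<Gamma>, \<sigma> \<phi>) \<in> R"
    and is_logic_wfD: "(\<Gamma>, \<phi>) \<in> R \<Longrightarrow> \<Gamma> \<subseteq> univ (Fm \<Sigma> Z) \<and> \<phi> \<in> univ (Fm \<Sigma> Z)"
proof -
  have cut: "cut_rel (univ (Fm \<Sigma> Z)) R" and struct: "structural_rel \<Sigma> Z R"
    using assms by (simp_all add: is_logic_def)
  show "\<Gamma> \<subseteq> univ (Fm \<Sigma> Z) \<Longrightarrow> \<phi> \<in> \<Gamma> \<Longrightarrow> (\<Gamma>, \<phi>) \<in> R"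
    using assms unfolding is_logic_def refl_rel_def by blast
  show "(\<Gamma>, \<phi>) \<in> R \<Longrightarrow> \<Gamma> \<subseteq> \<Delta> \<Longrightarrow> \<Delta> \<subseteq> univ (Fm \<Sigma> Z) \<Longrightarrow> (\<Delta>, \<phi>) \<in> R"
    using assms unfolding is_logic_def mono_rel_def by blast
  show "\<Gamma> \<subseteq> univ (Fm \<Sigma> Z) \<Longrightarrow> (\<And>\<psi>. \<psi> \<in> \<Delta> \<Longrightarrow> (\<Gamma>, \<psi>) \<in> R) \<Longrightarrow>
      (\<Delta>, \<phi>) \<in> R \<Longrightarrow> (\<Gamma>, \<phi>) \<in> R"
    using cut[unfolded cut_rel_def, THEN spec, THEN spec, THEN spec, of \<Gamma> \<Delta> \<phi>] by simp
  show "(\<Gamma>, \<phi>) \<in> R \<Longrightarrow> \<sigma> \<in> Homs \<Sigma> (Fm \<Sigma> Z) (Fm \<Sigma> Z) \<Longrightarrow> (\<sigma> ` \<Gamma>, \<sigma> \<phi>) \<in> R"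
    using struct by (auto simp: structural_rel_def)
  show "(\<Gamma>, \<phi>) \<in> R \<Longrightarrow> \<Gamma> \<subseteq> univ (Fm \<Sigma> Z) \<and> \<phi> \<in> univ (Fm \<Sigma> Z)"
    using assms unfolding is_logic_def by blast
qed

text \<open>Structurality on Fm Y covers only endomorphisms of Fm Y. Since \<Gamma> and \<phi> are
  over X, v may be replaced by an endomorphism extending it, with the same images.\<close>

lemma structural_rel_Homs:
  assumes "X \<subseteq> Y" and "X \<noteq> {}" and "structural_rel \<Sigma> Y T" and "(\<Gamma>, \<phi>) \<in> T"
    and "\<Gamma> \<subseteq> univ (Fm \<Sigma> X)" and "\<phi> \<in> univ (Fm \<Sigma> X)"
    and "v \<in> Homs \<Sigma> (Fm \<Sigma> X) (Fm \<Sigma> Y)"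
  shows "(v ` \<Gamma>, v \<phi>) \<in> T"
proof -
  obtain w where w: "w \<in> Homs \<Sigma> (Fm \<Sigma> Y) (Fm \<Sigma> Y)"
    and eq: "\<And>t. t \<in> univ (Fm \<Sigma> X) \<Longrightarrow> w t = v t"
    using Homs_Fm_extend[OF assms(1,2) is_algebra_Fm assms(7)] by metis
  have "(w ` \<Gamma>, w \<phi>) \<in> T"
    using assms(3,4) w unfolding structural_rel_def by blast
  moreover have "w ` \<Gamma> = v ` \<Gamma>"
    using assms(5) eq by (intro image_cong) auto
  ultimately show ?thesis using eq[OF assms(6)] by simp
qed

section \<open>Substitution instances: \<open>SS_ext\<close> as the structural closure of
  \<open>LS_ext\<close>\<close>

lemma SS_extI:
  assumes "\<Gamma> \<subseteq> univ (Fm \<Sigma> Y)" and "\<Gamma>' \<subseteq> univ (Fm \<Sigma> X)" and "\<phi>' \<in> univ (Fm \<Sigma> X)"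
    and "v \<in> Homs \<Sigma> (Fm \<Sigma> X) (Fm \<Sigma> Y)" and "v ` \<Gamma>' \<subseteq> \<Gamma>" and "(\<Gamma>', \<phi>') \<in> R"
  shows "(\<Gamma>, v \<phi>') \<in> SS_ext \<Sigma> X Y R"
proof -
  have "v \<phi>' \<in> univ (Fm \<Sigma> Y)" using assms(3,4) by (rule Homs_in_univ[rotated])
  with assms show ?thesis
    unfolding SS_ext_def
    by (intro CollectI case_prodI conjI exI[of _ \<Gamma>'] exI[of _ \<phi>'] bexI[of _ v]) auto
qed

text \<open>Every pair in \<open>SS_ext\<close> arises from a pair of R by one substitution followed
  by one weakening, and T admits both. This serves twice: for the minimality of the structural
  closure, and to place \<open>SS_ext\<close> below the filter consequence.\<close>

lemma SS_ext_subset_structural: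
  assumes "X \<subseteq> Y" and "X \<noteq> {}" and "R \<subseteq> T"
    and "mono_rel (univ (Fm \<Sigma> Y)) T" and "structural_rel \<Sigma> Y T"
  shows "SS_ext \<Sigma> X Y R \<subseteq> T"
proof (rule subrelI)
  fix \<Gamma> \<phi> assume "(\<Gamma>, \<phi>) \<in> SS_ext \<Sigma> X Y R"
  then obtain \<Gamma>' \<phi>' v where \<Gamma>: "\<Gamma> \<subseteq> univ (Fm \<Sigma> Y)"
    and sub: "\<Gamma>' \<subseteq> univ (Fm \<Sigma> X)" "\<phi>' \<in> univ (Fm \<Sigma> X)"
    and v: "v \<in> Homs \<Sigma> (Fm \<Sigma> X) (Fm \<Sigma> Y)" "v ` \<Gamma>' \<subseteq> \<Gamma>" "v \<phi>' = \<phi>"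
    and R: "(\<Gamma>', \<phi>') \<in> R"
    by (auto simp: SS_ext_def)
  from R have "(\<Gamma>', \<phi>') \<in> T" using assms(3) by blast
  from structural_rel_Homs[OF assms(1,2,5) this sub v(1)]
  have "(v ` \<Gamma>', \<phi>) \<in> T" using v(3) by simp
  with assms(4) v(2) \<Gamma> show "(\<Gamma>, \<phi>) \<in> T"
    unfolding mono_rel_def by blast
qed

text \<open>The automorphism v moves the rule into Fm X, so its inverse, restricted to Fm X, is a
  substitution that moves it back: the rule of R is the image under v, and the inverse is the
  witness for \<open>SS_ext\<close>.\<close>

lemma LS_ext_subset_SS_ext:
  assumes "X \<subseteq> Y"
  shows "LS_ext \<Sigma> X Y R \<subseteq> SS_ext \<Sigma> X Y R"
proof (rule subrelI)
  let ?M = "univ (Fm \<Sigma> Y)"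
  fix \<Gamma> \<phi> assume "(\<Gamma>, \<phi>) \<in> LS_ext \<Sigma> X Y R"
  then obtain v \<Gamma>' where \<Gamma>: "\<Gamma> \<subseteq> ?M" "\<phi> \<in> ?M" and v: "v \<in> Auts \<Sigma> (Fm \<Sigma> Y)"
    and \<Gamma>': "\<Gamma>' \<subseteq> \<Gamma>" and X: "v ` (\<Gamma>' \<union> {\<phi>}) \<subseteq> univ (Fm \<Sigma> X)"
    and R: "(v ` \<Gamma>', v \<phi>) \<in> R"
    unfolding LS_ext_def by blast
  let ?u = "inv_into ?M v"
  have u: "?u \<in> Homs \<Sigma> (Fm \<Sigma> X) (Fm \<Sigma> Y)"
    using Homs_Fm_restrict[OF assms inv_into_Auts_in_Homs[OF is_algebra_Fm v]] .
  have inj: "inj_on v ?M" using v by (simp add: Auts_def bij_betw_def)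
  have "?u ` v ` \<Gamma>' = \<Gamma>'" "?u (v \<phi>) = \<phi>"
    using inj \<Gamma> \<Gamma>' by (auto intro: inv_into_image_cancel)
  then show "(\<Gamma>, \<phi>) \<in> SS_ext \<Sigma> X Y R"
    using SS_extI[OF \<Gamma>(1) _ _ u _ R] X \<Gamma>' by auto
qed

text \<open>The identity is the witnessing automorphism. Consequently, a relation containing
  \<open>LS_ext\<close> contains R, which is what the minimality argument for \<open>SS_ext\<close>
  starts from.\<close>

lemma subset_LS_ext:
  assumes "X \<subseteq> Y" and "is_logic \<Sigma> X R"
  shows "R \<subseteq> LS_ext \<Sigma> X Y R"
proof (rule subrelI)
  fix \<Gamma> \<phi> assume R: "(\<Gamma>, \<phi>) \<in> R"
  note X = is_logic_wfD[OF assms(2) R]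
  have "id ` (\<Gamma> \<union> {\<phi>}) \<subseteq> univ (Fm \<Sigma> X) \<and> (id ` \<Gamma>, id \<phi>) \<in> R"
    using R X by simp
  moreover have "\<Gamma> \<subseteq> univ (Fm \<Sigma> Y)" "\<phi> \<in> univ (Fm \<Sigma> Y)"
    using X Fm_mono[OF assms(1)] by blast+
  ultimately show "(\<Gamma>, \<phi>) \<in> LS_ext \<Sigma> X Y R"
    unfolding LS_ext_def using id_in_Auts by blast
qed

lemma SS_ext_mono: "mono_rel (univ (Fm \<Sigma> Y)) (SS_ext \<Sigma> X Y R)"
  unfolding mono_rel_def
proof (intro allI impI, elim conjE)
  fix \<Gamma> \<Delta> \<phi>
  assume "(\<Gamma>, \<phi>) \<in> SS_ext \<Sigma> X Y R" and \<Delta>: "\<Gamma> \<subseteq> \<Delta>" "\<Delta> \<subseteq> univ (Fm \<Sigma> Y)"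
  then obtain \<Gamma>' \<phi>' v where X: "\<Gamma>' \<subseteq> univ (Fm \<Sigma> X)" "\<phi>' \<in> univ (Fm \<Sigma> X)"
    and v: "v \<in> Homs \<Sigma> (Fm \<Sigma> X) (Fm \<Sigma> Y)" "v ` \<Gamma>' \<subseteq> \<Gamma>" "v \<phi>' = \<phi>"
    and R: "(\<Gamma>', \<phi>') \<in> R"
    by (auto simp: SS_ext_def)
  show "(\<Delta>, \<phi>) \<in> SS_ext \<Sigma> X Y R"
    using SS_extI[OF \<Delta>(2) X v(1) order_trans[OF v(2) \<Delta>(1)] R] v(3) by simp
qed

lemma SS_ext_refl:
  assumes "X \<noteq> {}" and "is_logic \<Sigma> X R"
  shows "refl_rel (univ (Fm \<Sigma> Y)) (SS_ext \<Sigma> X Y R)"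
  unfolding refl_rel_def
proof (intro allI impI, elim conjE)
  fix \<Gamma> \<phi> assume \<Gamma>: "\<Gamma> \<subseteq> univ (Fm \<Sigma> Y)" and \<phi>: "\<phi> \<in> \<Gamma>"
  obtain x where "x \<in> X" using assms(1) by blast
  then have x: "Var x \<in> univ (Fm \<Sigma> X)" by (simp add: Fm_def terms.Var)
  \<comment> \<open>Reflexivity at \<phi> is an instance of x |- x: the substitution sends every
    variable to \<phi>, in particular the chosen x.\<close>
  let ?v = "extend (Fm \<Sigma> Y) (\<lambda>_. \<phi>)"
  have "?v \<in> Homs \<Sigma> (Fm \<Sigma> X) (Fm \<Sigma> Y)"
    using \<Gamma> \<phi> by (intro extend_in_Homs is_algebra_Fm) auto
  moreover have "({Var x}, Var x) \<in> R"
    using x by (intro is_logic_reflD[OF assms(2)]) auto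
  ultimately have "(\<Gamma>, ?v (Var x)) \<in> SS_ext \<Sigma> X Y R"
    using x \<phi> by (intro SS_extI[OF \<Gamma>, where \<Gamma>' = "{Var x}"]) auto
  then show "(\<Gamma>, \<phi>) \<in> SS_ext \<Sigma> X Y R" by simp
qed

lemma SS_ext_structural: "structural_rel \<Sigma> Y (SS_ext \<Sigma> X Y R)"
  unfolding structural_rel_def
proof (intro ballI, clarify)
  fix \<sigma> \<Gamma> \<phi>
  assume \<sigma>: "\<sigma> \<in> Homs \<Sigma> (Fm \<Sigma> Y) (Fm \<Sigma> Y)" and "(\<Gamma>, \<phi>) \<in> SS_ext \<Sigma> X Y R"
  then obtain \<Gamma>' \<phi>' v where \<Gamma>: "\<Gamma> \<subseteq> univ (Fm \<Sigma> Y)" "\<phi> \<in> univ (Fm \<Sigma> Y)"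
    and X: "\<Gamma>' \<union> {\<phi>'} \<subseteq> univ (Fm \<Sigma> X)"
    and v: "v \<in> Homs \<Sigma> (Fm \<Sigma> X) (Fm \<Sigma> Y)" "v ` \<Gamma>' \<subseteq> \<Gamma>" "v \<phi>' = \<phi>"
    and R: "(\<Gamma>', \<phi>') \<in> R"
    unfolding SS_ext_def by blast
  \<comment> \<open>The rule of R stays the same; only its witnessing substitution v is followed by
    \<sigma>.\<close>
  have "\<sigma> ` \<Gamma> \<subseteq> univ (Fm \<Sigma> Y)" "(\<sigma> \<circ> v) ` \<Gamma>' \<subseteq> \<sigma> ` \<Gamma>"
    using \<Gamma> v(2) Homs_in_univ[OF \<sigma>] by auto
  from SS_extI[OF this(1) _ _ Homs_comp[OF v(1) \<sigma>] this(2) R]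
  show "(\<sigma> ` \<Gamma>, \<sigma> \<phi>) \<in> SS_ext \<Sigma> X Y R"
    using X v(3) by auto
qed

lemma SS_ext_is_structural_closure:
  assumes "X \<subseteq> Y" and "X \<noteq> {}" and "is_logic \<Sigma> X R"
  shows "is_structural_closure \<Sigma> Y (LS_ext \<Sigma> X Y R) (SS_ext \<Sigma> X Y R)"
proof -
  let ?M = "univ (Fm \<Sigma> Y)" and ?S = "SS_ext \<Sigma> X Y R"
  have "?S \<subseteq> Pow ?M \<times> ?M"
    by (auto simp: SS_ext_def)
  moreover have "?S \<subseteq> T"
    if "mono_rel ?M T" "structural_rel \<Sigma> Y T" "LS_ext \<Sigma> X Y R \<subseteq> T" for T
    by (rule SS_ext_subset_structural[OF assms(1,2)
          order_trans[OF subset_LS_ext[OF assms(1,3)] that(3)] that(1,2)])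
  ultimately show ?thesis
    unfolding is_structural_closure_def Let_def
    by (simp add: SS_ext_mono SS_ext_refl[OF assms(2,3)] SS_ext_structural
        LS_ext_subset_SS_ext[OF assms(1)])
qed

section \<open>Filters\<close>

text \<open>An \<open>SS_ext\<close> step from F is an instance of a rule of R whose premises land
  in F. Filters are thus the pre-fixed points of the \<open>SS_ext\<close> operator, which links the
  filter consequence to the idempotent hull.\<close>

lemma filters_Fm_iff_SS_closed:
  assumes "is_logic \<Sigma> X R"
  shows "F \<in> filters \<Sigma> X R (Fm \<Sigma> Y) \<longleftrightarrow> F \<subseteq> univ (Fm \<Sigma> Y) \<and> rel_op (SS_ext \<Sigma> X Y R) F \<subseteq> F"
proof
  assume "F \<in> filters \<Sigma> X R (Fm \<Sigma> Y)"
  then show "F \<subseteq> univ (Fm \<Sigma> Y) \<and> rel_op (SS_ext \<Sigma> X Y R) F \<subseteq> F"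
    unfolding filters_def rel_op_def SS_ext_def by blast
next
  assume F: "F \<subseteq> univ (Fm \<Sigma> Y) \<and> rel_op (SS_ext \<Sigma> X Y R) F \<subseteq> F"
  have "v \<phi> \<in> F"
    if R: "(\<Gamma>, \<phi>) \<in> R" and v: "v \<in> Homs \<Sigma> (Fm \<Sigma> X) (Fm \<Sigma> Y)" "v ` \<Gamma> \<subseteq> F" for \<Gamma> \<phi> v
  proof -
    note X = is_logic_wfD[OF assms R]
    have "(F, v \<phi>) \<in> SS_ext \<Sigma> X Y R"
      using F X v R by (intro SS_extI) auto
    then show ?thesis using F unfolding rel_op_def by blast
  qed
  then show "F \<in> filters \<Sigma> X R (Fm \<Sigma> Y)"
    using F unfolding filters_def by blast
qed

lemma Log_filters_in_filter:
  assumes "F \<in> filters \<Sigma> X R (Fm \<Sigma> Y)" and "\<Gamma> \<subseteq> F" and "(\<Gamma>, \<phi>) \<in> Log_filters \<Sigma> X Y R"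
  shows "\<phi> \<in> F"
  using assms by (auto simp: Log_filters_def)

lemma filtersI:
  assumes "F \<subseteq> univ A"
    and "\<And>\<Gamma> \<phi> v. (\<Gamma>, \<phi>) \<in> R \<Longrightarrow> v \<in> Homs \<Sigma> (Fm \<Sigma> X) A \<Longrightarrow> v ` \<Gamma> \<subseteq> F \<Longrightarrow> v \<phi> \<in> F"
  shows "F \<in> filters \<Sigma> X R A"
  unfolding filters_def using assms by auto

lemma filtersD:
  assumes "F \<in> filters \<Sigma> X R A" and "(\<Gamma>, \<phi>) \<in> R" and "v \<in> Homs \<Sigma> (Fm \<Sigma> X) A" and "v ` \<Gamma> \<subseteq> F"
  shows "v \<phi> \<in> F"
  using assms by (auto simp: filters_def dest!: bspec[where x = "(\<Gamma>, \<phi>)"])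

text \<open>The set is the intersection, within Fm Y, of all filters containing \<Gamma>, and being
  a filter is preserved by intersection. It is therefore the filter generated by \<Gamma>.\<close>

lemma rel_op_Log_filters_in_filters:
  assumes "is_logic \<Sigma> X R" and \<Gamma>: "\<Gamma> \<subseteq> univ (Fm \<Sigma> Y)"
  shows "rel_op (Log_filters \<Sigma> X Y R) \<Gamma> \<in> filters \<Sigma> X R (Fm \<Sigma> Y)"
proof (rule filtersI)
  show "rel_op (Log_filters \<Sigma> X Y R) \<Gamma> \<subseteq> univ (Fm \<Sigma> Y)"
    by (auto simp: rel_op_def Log_filters_def)
next
  fix \<Delta> \<phi> v
  assume R: "(\<Delta>, \<phi>) \<in> R" and v: "v \<in> Homs \<Sigma> (Fm \<Sigma> X) (Fm \<Sigma> Y)"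
    and \<Delta>: "v ` \<Delta> \<subseteq> rel_op (Log_filters \<Sigma> X Y R) \<Gamma>"
  have "v \<phi> \<in> F" if F: "F \<in> filters \<Sigma> X R (Fm \<Sigma> Y)" "\<Gamma> \<subseteq> F" for F
  proof -
    have "v ` \<Delta> \<subseteq> F"
      using \<Delta> Log_filters_in_filter[OF F] by (auto simp: rel_op_def)
    then show ?thesis by (rule filtersD[OF F(1) R v])
  qed
  moreover have "v \<phi> \<in> univ (Fm \<Sigma> Y)"
    using is_logic_wfD[OF assms(1) R] Homs_in_univ[OF v] by blast
  ultimately show "v \<phi> \<in> rel_op (Log_filters \<Sigma> X Y R) \<Gamma>"
    using \<Gamma> by (simp add: rel_op_def Log_filters_def)
qed

text \<open>A homomorphism v into A whose premises land in the preimage becomes, composed with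
  \<sigma>, a homomorphism into B whose premises land in F. The preimage is cut down to the carrier
  because \<sigma> is unconstrained elsewhere.\<close>

lemma vimage_filter:
  assumes "is_logic \<Sigma> X R" and "F \<in> filters \<Sigma> X R B" and \<sigma>: "\<sigma> \<in> Homs \<Sigma> A B"
  shows "{a \<in> univ A. \<sigma> a \<in> F} \<in> filters \<Sigma> X R A"
proof (rule filtersI)
  fix \<Gamma> \<phi> v
  assume R: "(\<Gamma>, \<phi>) \<in> R" and v: "v \<in> Homs \<Sigma> (Fm \<Sigma> X) A"
    and \<Gamma>: "v ` \<Gamma> \<subseteq> {a \<in> univ A. \<sigma> a \<in> F}"
  have "(\<sigma> \<circ> v) ` \<Gamma> \<subseteq> F" using \<Gamma> by auto
  from filtersD[OF assms(2) R Homs_comp[OF v \<sigma>] this]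
  show "v \<phi> \<in> {a \<in> univ A. \<sigma> a \<in> F}"
    using is_logic_wfD[OF assms(1) R] Homs_in_univ[OF v] by auto
qed auto

section \<open>The filter consequence as the least logic on Fm Y extending R\<close>

lemma Log_filters_is_logic:
  assumes "is_logic \<Sigma> X R"
  shows "is_logic \<Sigma> Y (Log_filters \<Sigma> X Y R)"
  unfolding is_logic_def
proof (intro conjI)
  let ?M = "univ (Fm \<Sigma> Y)" and ?L = "Log_filters \<Sigma> X Y R"
  show "?L \<subseteq> Pow ?M \<times> ?M" "refl_rel ?M ?L" "mono_rel ?M ?L"
    by (auto simp: Log_filters_def refl_rel_def mono_rel_def)
  show "cut_rel ?M ?L"
    unfolding cut_rel_def
  proof (intro allI impI, elim conjE)
    fix \<Gamma> \<Delta> \<phi>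
    assume \<Gamma>: "\<Gamma> \<subseteq> ?M" and \<Delta>: "\<forall>\<psi>\<in>\<Delta>. (\<Gamma>, \<psi>) \<in> ?L" and \<phi>: "(\<Delta>, \<phi>) \<in> ?L"
    \<comment> \<open>A filter containing \<Gamma> contains every member of \<Delta>, and hence
      \<phi>.\<close>
    have "\<phi> \<in> F" if F: "F \<in> filters \<Sigma> X R (Fm \<Sigma> Y)" "\<Gamma> \<subseteq> F" for F
      using Log_filters_in_filter[OF F] Log_filters_in_filter[OF F(1) _ \<phi>] \<Delta> by blast
    then show "(\<Gamma>, \<phi>) \<in> ?L" using \<Gamma> \<phi> by (auto simp: Log_filters_def)
  qed
  show "structural_rel \<Sigma> Y ?L"
    unfolding structural_rel_def
  proof (intro ballI, clarify)
    fix \<sigma> \<Gamma> \<phi>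
    assume \<sigma>: "\<sigma> \<in> Homs \<Sigma> (Fm \<Sigma> Y) (Fm \<Sigma> Y)" and L: "(\<Gamma>, \<phi>) \<in> ?L"
    then have M: "\<Gamma> \<subseteq> ?M" "\<phi> \<in> ?M" by (auto simp: Log_filters_def)
    \<comment> \<open>The hypothesis on \<Gamma> is applied not to F but to its preimage under
      \<sigma>, a filter that contains \<Gamma>.\<close>
    have "\<sigma> \<phi> \<in> F" if F: "F \<in> filters \<Sigma> X R (Fm \<Sigma> Y)" "\<sigma> ` \<Gamma> \<subseteq> F" for F
    proof -
      have "\<Gamma> \<subseteq> {a \<in> ?M. \<sigma> a \<in> F}" using M F(2) by auto
      from Log_filters_in_filter[OF vimage_filter[OF assms F(1) \<sigma>] this L]
      show ?thesis by simp
    qed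
    then show "(\<sigma> ` \<Gamma>, \<sigma> \<phi>) \<in> ?L"
      using M Homs_in_univ[OF \<sigma>] by (auto simp: Log_filters_def)
  qed
qed

text \<open>Closure of a filter under R is used at the inclusion of Fm X into Fm Y.\<close>

lemma subset_Log_filters:
  assumes "X \<subseteq> Y" and "is_logic \<Sigma> X R"
  shows "R \<subseteq> Log_filters \<Sigma> X Y R"
proof (rule subrelI)
  fix \<Gamma> \<phi> assume R: "(\<Gamma>, \<phi>) \<in> R"
  have "\<phi> \<in> F" if "F \<in> filters \<Sigma> X R (Fm \<Sigma> Y)" "\<Gamma> \<subseteq> F" for F
    using filtersD[OF that(1) R id_in_Homs_Fm[OF assms(1)]] that(2) by simp
  then show "(\<Gamma>, \<phi>) \<in> Log_filters \<Sigma> X Y R"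
    using is_logic_wfD[OF assms(2) R] Fm_mono[OF assms(1)] by (auto simp: Log_filters_def)
qed

text \<open>A rule of R belongs to S, so its instance under v does too by structurality over the
  extended substitution; its premises follow from \<Gamma>, and cut finishes.\<close>

lemma logic_theory_in_filters:
  assumes "X \<subseteq> Y" and "X \<noteq> {}" and "is_logic \<Sigma> X R" and "is_logic \<Sigma> Y S" and "R \<subseteq> S"
    and \<Gamma>: "\<Gamma> \<subseteq> univ (Fm \<Sigma> Y)"
  shows "rel_op S \<Gamma> \<in> filters \<Sigma> X R (Fm \<Sigma> Y)"
proof (rule filtersI)
  show "rel_op S \<Gamma> \<subseteq> univ (Fm \<Sigma> Y)"
    using is_logic_wfD[OF assms(4)] by (auto simp: rel_op_def)
next
  fix \<Delta> \<phi> v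
  assume R: "(\<Delta>, \<phi>) \<in> R" and v: "v \<in> Homs \<Sigma> (Fm \<Sigma> X) (Fm \<Sigma> Y)" and \<Delta>: "v ` \<Delta> \<subseteq> rel_op S \<Gamma>"
  have "structural_rel \<Sigma> Y S" using assms(4) by (simp add: is_logic_def)
  then have "(v ` \<Delta>, v \<phi>) \<in> S"
    using R assms(5) is_logic_wfD[OF assms(3) R] v
    by (intro structural_rel_Homs[OF assms(1,2)]) auto
  moreover have "(\<Gamma>, \<psi>) \<in> S" if "\<psi> \<in> v ` \<Delta>" for \<psi>
    using that \<Delta> by (auto simp: rel_op_def)
  ultimately have "(\<Gamma>, v \<phi>) \<in> S"
    by (rule is_logic_cutD[OF assms(4) \<Gamma>, rotated])
  then show "v \<phi> \<in> rel_op S \<Gamma>" by (simp add: rel_op_def)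
qed

lemma minus_ext_eq_Log_filters:
  assumes "X \<subseteq> Y" and "X \<noteq> {}" and "is_logic \<Sigma> X R"
  shows "minus_ext \<Sigma> Y R = Log_filters \<Sigma> X Y R"
proof
  show "minus_ext \<Sigma> Y R \<subseteq> Log_filters \<Sigma> X Y R"
    by (intro minus_ext_smallest Log_filters_is_logic subset_Log_filters assms)
  show "Log_filters \<Sigma> X Y R \<subseteq> minus_ext \<Sigma> Y R"
    unfolding minus_ext_def
  proof (intro Inter_greatest subrelI)
    fix S \<Gamma> \<phi> assume "S \<in> {S. is_logic \<Sigma> Y S \<and> R \<subseteq> S}" and L: "(\<Gamma>, \<phi>) \<in> Log_filters \<Sigma> X Y R"
    then have S: "is_logic \<Sigma> Y S" "R \<subseteq> S" by auto
    have \<Gamma>: "\<Gamma> \<subseteq> univ (Fm \<Sigma> Y)" using L by (simp add: Log_filters_def)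
    \<comment> \<open>The S-theory of \<Gamma> is itself one of the filters over which
      \<open>Log_filters\<close> quantifies.\<close>
    then have "\<Gamma> \<subseteq> rel_op S \<Gamma>"
      using is_logic_reflD[OF S(1)] by (auto simp: rel_op_def)
    from Log_filters_in_filter[OF logic_theory_in_filters[OF assms S \<Gamma>] this L]
    show "(\<Gamma>, \<phi>) \<in> S" by (simp add: rel_op_def)
  qed
qed

section \<open>The upper bound: \<open>plus_card_ext\<close> for a regular cardinal\<close>

lemma plus_ext_refl:
  assumes "is_logic \<Sigma> X R" and "\<Gamma> \<subseteq> univ (Fm \<Sigma> Y)" and "\<phi> \<in> \<Gamma>"
  shows "(\<Gamma>, \<phi>) \<in> plus_ext \<Sigma> X Y R"
proof -
  have "(\<sigma> ` \<Gamma>, \<sigma> \<phi>) \<in> R" if "\<sigma> \<in> Homs \<Sigma> (Fm \<Sigma> Y) (Fm \<Sigma> X)" for \<sigma>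
    using assms Homs_in_univ[OF that] by (intro is_logic_reflD[OF assms(1)]) auto
  then show ?thesis using assms by (auto simp: plus_ext_def)
qed

text \<open>Cut for premises that come with separate premise sets. For each \<sigma> the composite
  of v and \<sigma> is an endomorphism of Fm X, so structurality of R applies; the derivations of
  the single premises are weakened to the union, and cut in R joins them.\<close>

lemma plus_ext_trans:
  assumes "is_logic \<Sigma> X R" and R: "(\<Delta>, \<phi>) \<in> R" and v: "v \<in> Homs \<Sigma> (Fm \<Sigma> X) (Fm \<Sigma> Y)"
    and \<Delta>: "\<And>\<delta>. \<delta> \<in> \<Delta> \<Longrightarrow> (G \<delta>, v \<delta>) \<in> plus_ext \<Sigma> X Y R"
  shows "(\<Union>(G ` \<Delta>), v \<phi>) \<in> plus_ext \<Sigma> X Y R"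
proof -
  have sub: "\<Union>(G ` \<Delta>) \<subseteq> univ (Fm \<Sigma> Y)" using \<Delta> by (auto simp: plus_ext_def)
  have "(\<sigma> ` \<Union>(G ` \<Delta>), \<sigma> (v \<phi>)) \<in> R" if \<sigma>: "\<sigma> \<in> Homs \<Sigma> (Fm \<Sigma> Y) (Fm \<Sigma> X)" for \<sigma>
  proof (rule is_logic_cutD[OF assms(1)])
    show \<sigma>sub: "\<sigma> ` \<Union>(G ` \<Delta>) \<subseteq> univ (Fm \<Sigma> X)"
      using sub Homs_in_univ[OF \<sigma>] by auto
    show "((\<sigma> \<circ> v) ` \<Delta>, \<sigma> (v \<phi>)) \<in> R"
      using is_logic_structuralD[OF assms(1) R Homs_comp[OF v \<sigma>]] by simp
    show "(\<sigma> ` \<Union>(G ` \<Delta>), \<psi>) \<in> R" if "\<psi> \<in> (\<sigma> \<circ> v) ` \<Delta>" for \<psi>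
    proof -
      from that obtain \<delta> where \<delta>: "\<delta> \<in> \<Delta>" "\<psi> = \<sigma> (v \<delta>)" by auto
      have "(\<sigma> ` G \<delta>, \<psi>) \<in> R" using \<Delta>[OF \<delta>(1)] \<sigma> \<delta>(2) by (simp add: plus_ext_def)
      then show ?thesis using \<delta>(1) \<sigma>sub by (elim is_logic_monoD[OF assms(1)]) auto
    qed
  qed
  moreover have "v \<phi> \<in> univ (Fm \<Sigma> Y)"
    using is_logic_wfD[OF assms(1) R] Homs_in_univ[OF v] by blast
  ultimately show ?thesis using sub by (simp add: plus_ext_def)
qed

lemma plus_card_theory_in_filters:
  assumes "is_logic \<Sigma> X R" and "bounded_by R \<kappa>" and "Cinfinite \<kappa>" and "regularCard \<kappa>"
    and \<Gamma>: "\<Gamma> \<subseteq> univ (Fm \<Sigma> Y)"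
  shows "rel_op (plus_card_ext \<Sigma> X Y \<kappa> R) \<Gamma> \<in> filters \<Sigma> X R (Fm \<Sigma> Y)"
proof (rule filtersI)
  show "rel_op (plus_card_ext \<Sigma> X Y \<kappa> R) \<Gamma> \<subseteq> univ (Fm \<Sigma> Y)"
    by (auto simp: rel_op_def plus_card_ext_def)
next
  fix \<Delta> \<phi> v
  assume \<phi>: "(\<Delta>, \<phi>) \<in> R" and v: "v \<in> Homs \<Sigma> (Fm \<Sigma> X) (Fm \<Sigma> Y)"
    and \<Delta>: "v ` \<Delta> \<subseteq> rel_op (plus_card_ext \<Sigma> X Y \<kappa> R) \<Gamma>"
  \<comment> \<open>Regularity bounds unions only over index sets smaller than \<kappa>, so the
    premises are first thinned out by the cardinality bound on R.\<close>
  obtain \<Delta>' where \<Delta>': "\<Delta>' \<subseteq> \<Delta>" "|\<Delta>'| <o \<kappa>" and R: "(\<Delta>', \<phi>) \<in> R"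
    using bspec[OF assms(2)[unfolded bounded_by_def] \<phi>] by auto
  have "\<exists>G. G \<subseteq> \<Gamma> \<and> |G| <o \<kappa> \<and> (G, v \<delta>) \<in> plus_ext \<Sigma> X Y R" if "\<delta> \<in> \<Delta>'" for \<delta>
  proof -
    have "v \<delta> \<in> rel_op (plus_card_ext \<Sigma> X Y \<kappa> R) \<Gamma>" using that \<Delta> \<Delta>'(1) by blast
    then show ?thesis by (simp add: rel_op_def plus_card_ext_def)
  qed
  \<comment> \<open>One small premise set is chosen for each remaining premise; their union stays
    below \<kappa> by regularity.\<close>
  then obtain G where G: "\<And>\<delta>. \<delta> \<in> \<Delta>' \<Longrightarrow> G \<delta> \<subseteq> \<Gamma>" "\<And>\<delta>. \<delta> \<in> \<Delta>' \<Longrightarrow> |G \<delta>| <o \<kappa>"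
    "\<And>\<delta>. \<delta> \<in> \<Delta>' \<Longrightarrow> (G \<delta>, v \<delta>) \<in> plus_ext \<Sigma> X Y R"
    by metis
  have "|\<Union>(G ` \<Delta>')| <o \<kappa>"
    by (rule regularCard_UNION_bound[OF assms(3,4) \<Delta>'(2) G(2)])
  moreover have "\<Union>(G ` \<Delta>') \<subseteq> \<Gamma>" using G(1) by blast
  moreover have "(\<Union>(G ` \<Delta>'), v \<phi>) \<in> plus_ext \<Sigma> X Y R"
    by (rule plus_ext_trans[OF assms(1) R v G(3)])
  moreover from this have "v \<phi> \<in> univ (Fm \<Sigma> Y)" by (simp add: plus_ext_def)
  ultimately show "v \<phi> \<in> rel_op (plus_card_ext \<Sigma> X Y \<kappa> R) \<Gamma>"
    using \<Gamma> by (auto simp: rel_op_def plus_card_ext_def)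
qed

lemma Log_filters_subset_plus_card_ext:
  assumes "is_logic \<Sigma> X R" and "bounded_by R \<kappa>" and "Cinfinite \<kappa>" and "regularCard \<kappa>"
  shows "Log_filters \<Sigma> X Y R \<subseteq> plus_card_ext \<Sigma> X Y \<kappa> R"
proof (rule subrelI)
  fix \<Gamma> \<phi> assume L: "(\<Gamma>, \<phi>) \<in> Log_filters \<Sigma> X Y R"
  then have \<Gamma>: "\<Gamma> \<subseteq> univ (Fm \<Sigma> Y)" by (simp add: Log_filters_def)
  have "\<Gamma> \<subseteq> rel_op (plus_card_ext \<Sigma> X Y \<kappa> R) \<Gamma>"
  proof
    fix \<psi> assume \<psi>: "\<psi> \<in> \<Gamma>"
    \<comment> \<open>The singleton of \<psi> is a sufficient premise set, and it is small because
      \<kappa> is infinite.\<close>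
    have "|{\<psi>}| <o \<kappa>"
      using assms(3) by (intro Cfinite_ordLess_Cinfinite)
        (auto simp: cfinite_def Field_card_of card_of_card_order_on)
    moreover have "({\<psi>}, \<psi>) \<in> plus_ext \<Sigma> X Y R"
      using \<psi> \<Gamma> by (intro plus_ext_refl assms(1)) auto
    ultimately show "\<psi> \<in> rel_op (plus_card_ext \<Sigma> X Y \<kappa> R) \<Gamma>"
      using \<psi> \<Gamma> by (auto simp: rel_op_def plus_card_ext_def intro: exI[of _ "{\<psi>}"])
  qed
  from Log_filters_in_filter[OF plus_card_theory_in_filters[OF assms \<Gamma>] this L]
  show "(\<Gamma>, \<phi>) \<in> plus_card_ext \<Sigma> X Y \<kappa> R" by (simp add: rel_op_def)
qed

section \<open>Idempotent hulls through least closed supersets\<close>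

lemma is_idempotent_hullI:
  assumes E: "increasing_monotone_op M E"
    and C: "\<And>S. S \<subseteq> M \<Longrightarrow> S \<subseteq> C S \<and> C S \<subseteq> M \<and> E (C S) \<subseteq> C S"
    and least: "\<And>S F. S \<subseteq> F \<Longrightarrow> F \<subseteq> M \<Longrightarrow> E F \<subseteq> F \<Longrightarrow> C S \<subseteq> F"
  shows "is_idempotent_hull M E C"
proof -
  have extensive: "S \<subseteq> E S" if "S \<subseteq> M" for S
    using E that by (simp add: increasing_monotone_op_def)
  have mono: "E S \<subseteq> E T" if "S \<subseteq> T" "T \<subseteq> M" for S T
    using E that by (simp add: increasing_monotone_op_def)
  \<comment> \<open>\<open>C S\<close> is already closed under E, so the least closed superset of it
    is itself.\<close>
  have "C (C S) = C S" if "S \<subseteq> M" for S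
    using C[OF that] C[of "C S"] least[of "C S" "C S"] by blast
  then have "idempotent_op M C" using C by (simp add: idempotent_op_def)
  moreover have "E S \<subseteq> C S" if "S \<subseteq> M" for S
    using mono[of S "C S"] C[OF that] by blast
  \<comment> \<open>Idempotence makes \<open>D S\<close> closed under E, since E (D S) is contained
    in D (D S) = D S. As \<open>D S\<close> also contains S, leastness of \<open>C S\<close>
    applies.\<close>
  moreover have "C S \<subseteq> D S" if D: "idempotent_op M D" "\<And>S. S \<subseteq> M \<Longrightarrow> E S \<subseteq> D S" and S: "S \<subseteq> M" for D S
  proof (rule least)
    show DS: "D S \<subseteq> M" using D(1) S by (simp add: idempotent_op_def)
    show "S \<subseteq> D S" using extensive[OF S] D(2)[OF S] by blast
    show "E (D S) \<subseteq> D S" using D(2)[OF DS] D(1) S by (simp add: idempotent_op_def)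
  qed
  ultimately show ?thesis using E by (simp add: is_idempotent_hull_def)
qed

text \<open>By \<open>filters_Fm_iff_SS_closed\<close>, the sets closed under the
  \<open>SS_ext\<close> operator are the filters, and the filter consequence assigns to S the least
  filter containing it.\<close>

lemma Log_filters_is_idempotent_hull:
  assumes "X \<noteq> {}" and l: "is_logic \<Sigma> X R"
  shows "is_idempotent_hull (univ (Fm \<Sigma> Y)) (rel_op (SS_ext \<Sigma> X Y R)) (rel_op (Log_filters \<Sigma> X Y R))"
proof (rule is_idempotent_hullI)
  let ?M = "univ (Fm \<Sigma> Y)" and ?SS = "SS_ext \<Sigma> X Y R" and ?L = "Log_filters \<Sigma> X Y R"
  have "refl_rel ?M ?SS" "mono_rel ?M ?SS" "?SS \<subseteq> Pow ?M \<times> ?M"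
    using SS_ext_refl[OF assms] SS_ext_mono by (auto simp: SS_ext_def)
  then show "increasing_monotone_op ?M (rel_op ?SS)"
    by (auto simp: increasing_monotone_op_def refl_rel_def mono_rel_def rel_op_def)
  show "S \<subseteq> rel_op ?L S \<and> rel_op ?L S \<subseteq> ?M \<and> rel_op ?SS (rel_op ?L S) \<subseteq> rel_op ?L S" if "S \<subseteq> ?M" for S
  proof -
    have "S \<subseteq> rel_op ?L S"
      using that is_logic_reflD[OF Log_filters_is_logic[OF l]] by (auto simp: rel_op_def)
    then show ?thesis
      using rel_op_Log_filters_in_filters[OF l that] by (simp add: filters_Fm_iff_SS_closed[OF l])
  qed
  show "rel_op ?L S \<subseteq> F" if "S \<subseteq> F" "F \<subseteq> ?M" "rel_op ?SS F \<subseteq> F" for S F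
  proof -
    have "F \<in> filters \<Sigma> X R (Fm \<Sigma> Y)"
      using that filters_Fm_iff_SS_closed[OF l] by simp
    from Log_filters_in_filter[OF this that(1)] show ?thesis by (auto simp: rel_op_def)
  qed
qed

theorem theorem3p14:
  fixes \<Sigma> :: "'f signature"
    and X Y :: "'x set"
    and R :: "('f, 'x) fterm crel"
    and \<kappa> :: "'k rel"
  assumes "infinite X" and "X \<subseteq> Y"
    and "is_logic \<Sigma> X R"
    and "is_cardinality R \<kappa>" and "regularCard \<kappa>"
  shows "LS_ext \<Sigma> X Y R \<subseteq> SS_ext \<Sigma> X Y R
    \<and> SS_ext \<Sigma> X Y R \<subseteq> minus_ext \<Sigma> Y R
    \<and> minus_ext \<Sigma> Y R = Log_filters \<Sigma> X Y R
    \<and> Log_filters \<Sigma> X Y R \<subseteq> plus_card_ext \<Sigma> X Y \<kappa> R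
    \<and> is_structural_closure \<Sigma> Y (LS_ext \<Sigma> X Y R) (SS_ext \<Sigma> X Y R)
    \<and> is_idempotent_hull (univ (Fm \<Sigma> Y)) (rel_op (SS_ext \<Sigma> X Y R)) (rel_op (minus_ext \<Sigma> Y R))"
proof -
  have X: "X \<noteq> {}" using assms(1) by auto
  note eq = minus_ext_eq_Log_filters[OF assms(2) X assms(3)]
  have "is_logic \<Sigma> Y (Log_filters \<Sigma> X Y R)"
    by (rule Log_filters_is_logic[OF assms(3)])
  \<comment> \<open>Being a logic, the filter consequence is monotone and structural, and it
    contains R. The equation \<open>eq\<close> later turns this bound into the one for
    \<open>minus_ext\<close>.\<close>
  then have "SS_ext \<Sigma> X Y R \<subseteq> Log_filters \<Sigma> X Y R"
    by (intro SS_ext_subset_structural[OF assms(2) X subset_Log_filters[OF assms(2,3)]])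
      (simp_all add: is_logic_def)
  moreover have "Cinfinite \<kappa>" "bounded_by R \<kappa>"
    using assms(4) by (auto simp: is_cardinality_def)
  then have "Log_filters \<Sigma> X Y R \<subseteq> plus_card_ext \<Sigma> X Y \<kappa> R"
    by (intro Log_filters_subset_plus_card_ext assms(3,5))
  ultimately show ?thesis
    using LS_ext_subset_SS_ext[OF assms(2)] SS_ext_is_structural_closure[OF assms(2) X assms(3)]
      Log_filters_is_idempotent_hull[OF X assms(3)]
    by (simp add: eq)
qed

end
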